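(* Let $n,N\in\mathbb N$, let $\widehat{\mathsf Q}_1,\dots,\widehat{\mathsf Q}_N\in\mathcal S^n$, $\widehat{\mathbb P}_N=\frac1N\sum_{i=1}^N\delta_{\widehat{\mathsf Q}_i}$ and $\overline{\mathsf Q}=\frac1N\sum_{i=1}^N\widehat{\mathsf Q}_i$. Let $p\ge1$, let the Wasserstein distance be taken with respect to the Frobenius norm, and let $\theta:\Delta\to(0,\infty)$ be any function. Then $$\inf_{\mathbf x\in\Delta}\ \sup_{\mathbb P\in\mathbb B_{\theta(\mathbf x),p}(\widehat{\mathbb P}_N)}\mathbb E_{\mathbb P}[\mathbf x^\top\widetilde{\mathsf Q}\mathbf x]=\inf_{\mathbf x\in\Delta}\ \mathbf x^\top[\overline{\mathsf Q}+\theta(\mathbf x)\,\mathsf I]\mathbf x=\inf_{\mathbf x\in\Delta}\big[\mathbf x^\top\overline{\mathsf Q}\mathbf x+\theta(\mathbf x)\,\mathbf x^\top\mathbf x\big].$$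
   Context: $\mathcal S^n$ is the space of real symmetric $n\times n$ matrices, $\mathsf I$ the identity matrix, $\Delta=\{\mathbf x\in\mathbb R^n:\mathbf x\ge\mathbf 0,\sum_ix_i=1\}$. $\mathbb E_{\mathbb P}$ is expectation when the random symmetric matrix $\widetilde{\mathsf Q}$ has law $\mathbb P$. $W_p(\mathbb P,\mathbb P')=\big(\inf_{\pi}\int\|\mathsf Q-\mathsf Q'\|_F^p\,\mathrm d\pi(\mathsf Q,\mathsf Q')\big)^{1/p}$, infimum over couplings $\pi$ of $\mathbb P$ and $\mathbb P'$; for $r>0$, $\mathbb B_{r,p}(\mathbb P')$ is the set of Borel probability measures $\mathbb P$ on $\mathcal S^n$ with $W_p(\mathbb P,\mathbb P')\le r$. *)

theory Defs
  imports "HOL-Probability.Probability"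
begin

definition sym_matrices :: "(real^'n^'n) set" where
  "sym_matrices = {A. transpose A = A}"

abbreviation sym_borel :: "(real^'n^'n) measure" where
  "sym_borel \<equiv> restrict_space borel sym_matrices"

definition unit_simplex :: "(real^'n) set" where
  "unit_simplex = {x. (\<forall>i. 0 \<le> x $ i) \<and> (\<Sum>i\<in>UNIV. x $ i) = 1}"

definition prob_laws :: "(real^'n^'n) measure set" where
  "prob_laws = {P. prob_space P \<and> sets P = sets sym_borel}"

definition empirical_mean :: "nat \<Rightarrow> (nat \<Rightarrow> real^'n^'n) \<Rightarrow> real^'n^'n" where
  "empirical_mean N Q = (1 / real N) *\<^sub>R (\<Sum>i=1..N. Q i)"

text \<open>\<^term>\<open>return M x\<close> is the Dirac measure at \<open>x\<close>.\<close>

definition empirical_law :: "nat \<Rightarrow> (nat \<Rightarrow> real^'n^'n) \<Rightarrow> (real^'n^'n) measure" where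
  "empirical_law N Q = measure_of (space sym_borel) (sets sym_borel)
     (\<lambda>A. (1 / of_nat N) * (\<Sum>i=1..N. emeasure (return sym_borel (Q i)) A))"

definition couplings :: "'a measure \<Rightarrow> 'b measure \<Rightarrow> ('a \<times> 'b) measure set" where
  "couplings P P' = {\<pi>. sets \<pi> = sets (P \<Otimes>\<^sub>M P') \<and> distr \<pi> P fst = P \<and> distr \<pi> P' snd = P'}"

definition ennreal_root :: "real \<Rightarrow> ennreal \<Rightarrow> ennreal" where
  "ennreal_root p a = (if a = \<infinity> then \<infinity> else ennreal (enn2real a powr (1 / p)))"

text \<open>The norm of \<^typ>\<open>real^'n^'n\<close> is the Frobenius norm; see \<open>norm_matrix_frobenius\<close> below.
  The distance is extended-valued, so laws without a finite \<open>p\<close>-th moment are admitted.\<close>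

definition wasserstein :: "real \<Rightarrow> (real^'n^'n) measure \<Rightarrow> (real^'n^'n) measure \<Rightarrow> ennreal" where
  "wasserstein p P P' = ennreal_root p
     (INF \<pi>\<in>couplings P P'. \<integral>\<^sup>+ (A, B). ennreal (norm (A - B) powr p) \<partial>\<pi>)"

definition wasserstein_ball ::
    "real \<Rightarrow> real \<Rightarrow> (real^'n^'n) measure \<Rightarrow> (real^'n^'n) measure set" where
  "wasserstein_ball r p P' = {P \<in> prob_laws. wasserstein p P P' \<le> ennreal r}"

lemma norm_matrix_frobenius:
  fixes A :: "real^'n^'m"
  shows "norm A = sqrt (\<Sum>i\<in>UNIV. \<Sum>j\<in>UNIV. (A $ i $ j)\<^sup>2)"
  by (simp add: norm_vec_def L2_set_def sum_nonneg)

lemma emeasure_empirical_law: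
  fixes Q :: "nat \<Rightarrow> real^'n^'n"
  assumes "A \<in> sets sym_borel"
  shows "emeasure (empirical_law N Q) A
    = (1 / of_nat N) * (\<Sum>i=1..N. emeasure (return sym_borel (Q i)) A)"
proof -
  let ?\<mu> = "\<lambda>A :: (real^'n^'n) set. (1 / of_nat N) * (\<Sum>i=1..N. emeasure (return sym_borel (Q i)) A)"
  have "countably_additive (sets (sym_borel :: (real^'n^'n) measure)) ?\<mu>"
  proof (rule countably_additiveI)
    fix F :: "nat \<Rightarrow> (real^'n^'n) set"
    assume F: "range F \<subseteq> sets sym_borel" "disjoint_family F"
    have "(\<Sum>n. ?\<mu> (F n)) = (1 / of_nat N) * (\<Sum>i=1..N. \<Sum>n. emeasure (return sym_borel (Q i)) (F n))"
      by (simp add: suminf_sum)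
    also have "\<dots> = ?\<mu> (\<Union>n. F n)"
      using F by (intro arg_cong2[where f = "(*)"] sum.cong refl suminf_emeasure) simp_all
    finally show "(\<Sum>n. ?\<mu> (F n)) = ?\<mu> (\<Union>n. F n)" .
  qed
  then show ?thesis
    using assms unfolding empirical_law_def
    by (intro emeasure_measure_of_sigma) (auto simp: sets.sigma_algebra_axioms positive_def)
qed

lemma empirical_law_in_prob_laws:
  assumes "N \<ge> 1" and "\<And>i. i \<in> {1..N} \<Longrightarrow> Q i \<in> sym_matrices"
  shows "empirical_law N Q \<in> prob_laws"
proof -
  have sets: "sets (empirical_law N Q) = sets sym_borel"
    by (simp add: empirical_law_def)
  have "emeasure (empirical_law N Q) (space sym_borel)
      = (1 / of_nat N) * (\<Sum>i=1..N. emeasure (return sym_borel (Q i)) (space sym_borel))"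
    by (rule emeasure_empirical_law) (rule sets.top)
  also have "(\<Sum>i=1..N. emeasure (return sym_borel (Q i)) (space sym_borel)) = (\<Sum>i=1..N. 1)"
    using assms(2)
    by (intro sum.cong refl, subst emeasure_return[OF sets.top]) (auto simp: space_restrict_space)
  also have "(1 / of_nat N) * (\<Sum>i=1..N. (1::ennreal)) = 1"
    using assms(1) by (auto simp: ennreal_divide_times intro!: ennreal_divide_self of_nat_less_top)
  finally have "emeasure (empirical_law N Q) (space (empirical_law N Q)) = 1"
    using sets_eq_imp_space_eq[OF sets] by simp
  then show ?thesis
    using sets by (auto simp: prob_laws_def intro: prob_spaceI)
qed

end

theory Submission
  imports Defs
begin

text \<open>
  For fixed \<open>x\<close> the quadratic form \<open>A \<mapsto> x \<bullet> (A *v x)\<close> is the Frobenius inner product of \<open>A\<close> with the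
  rank-one matrix \<open>x x\<^sup>T\<close>, and that matrix has Frobenius norm \<open>x \<bullet> x\<close>. The form is therefore
  Lipschitz with constant exactly \<open>x \<bullet> x\<close>, so moving a law by Wasserstein distance \<open>r\<close> changes the
  expected form by at most \<open>r * (x \<bullet> x)\<close>. The bound is the same for every exponent \<open>p \<ge> 1\<close>, because
  the \<open>L\<^sup>p\<close> norm of the displacement under a coupling dominates its \<open>L\<^sup>1\<close> norm. This gives
  \<open>wasserstein_ball_Lipschitz_integral_le\<close>.

  For \<open>x \<noteq> 0\<close>, as in the simplex, let \<open>D\<close> be the multiple of \<open>x x\<^sup>T\<close> of norm \<open>r\<close>. Translating every
  atom of the empirical law by \<open>D\<close> makes the displacement constant, so its \<open>L\<^sup>p\<close> norm is \<open>r\<close> for every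
  \<open>p\<close> (\<open>shifted_empirical_law_in_wasserstein_ball\<close>). Since \<open>D\<close> is aligned with the gradient \<open>x x\<^sup>T\<close>,
  equality holds in Cauchy--Schwarz and the bound is attained.

  The inner supremum thus has a closed form for each single \<open>x\<close> (\<open>worst_case_quadratic_form\<close>), and
  the radius may depend on \<open>x\<close> in any way before the infimum is taken.
\<close>

section \<open>Quadratic forms and the Frobenius inner product\<close>

definition outer_square :: "real^'n \<Rightarrow> real^'n^'n" where
  "outer_square x = (\<chi> i j. x $ i * x $ j)"

lemma quadratic_form_eq_inner_outer_square: "x \<bullet> (A *v x) = A \<bullet> outer_square x"
  by (simp add: outer_square_def inner_vec_def matrix_vector_mult_def sum_distrib_left mult_ac)

lemma outer_square_mult_vec: "outer_square x *v x = (x \<bullet> x) *\<^sub>R x"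
  by (simp add: outer_square_def vec_eq_iff inner_vec_def matrix_vector_mult_def sum_distrib_left mult_ac)

lemma norm_outer_square: "norm (outer_square x) = x \<bullet> x"
proof -
  \<comment> \<open>The squared norm is the quadratic form of \<open>x x\<^sup>T\<close> at its own eigenvector \<open>x\<close>.\<close>
  have "outer_square x \<bullet> outer_square x = (x \<bullet> x)\<^sup>2"
    by (simp add: quadratic_form_eq_inner_outer_square[symmetric] outer_square_mult_vec power2_eq_square)
  then show ?thesis
    by (simp add: norm_eq_sqrt_inner)
qed

lemma outer_square_in_sym_matrices: "outer_square x \<in> sym_matrices"
  by (simp add: outer_square_def sym_matrices_def transpose_def mult.commute)

text \<open>
  Cauchy--Schwarz for the Frobenius inner product, which gives the sharp constant without any
  operator norm.
\<close>

lemma quadratic_form_Lipschitz: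
  fixes x :: "real^'n"
  shows "\<bar>x \<bullet> (A *v x) - x \<bullet> (B *v x)\<bar> \<le> (x \<bullet> x) * norm (A - B)"
  using Cauchy_Schwarz_ineq2[of "A - B" "outer_square x"]
  by (simp add: quadratic_form_eq_inner_outer_square inner_diff_left norm_outer_square mult.commute)

lemma
  shows sym_matrices_add: "A \<in> sym_matrices \<Longrightarrow> B \<in> sym_matrices \<Longrightarrow> A + B \<in> sym_matrices"
    and sym_matrices_scaleR: "A \<in> sym_matrices \<Longrightarrow> c *\<^sub>R A \<in> sym_matrices"
  by (simp_all add: sym_matrices_def transpose_def vec_eq_iff)

lemma borel_measurable_quadratic_form:
  "(\<lambda>A. x \<bullet> (A *v x)) \<in> borel_measurable (borel :: (real^'n^'n) measure)"
  unfolding quadratic_form_eq_inner_outer_square by measurable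

section \<open>Expectations of Lipschitz functions over a Wasserstein ball\<close>

lemma measurable_of_sets_sym_borel:
  "sets M = sets sym_borel \<Longrightarrow> f \<in> measurable borel M' \<Longrightarrow> f \<in> measurable M M'"
  by (simp add: measurable_restrict_space1 cong: measurable_cong_sets)

text \<open>
  Weighted arithmetic-geometric mean with weights \<open>1 / p\<close> and \<open>1 - 1 / p\<close>. The right-hand side is
  affine in \<open>t powr p\<close> and equals \<open>c\<close> at \<open>t = c\<close>, so integrating it turns a bound on a \<open>p\<close>-th moment
  into a bound on a first moment.
\<close>

lemma powr_weighted_bound:
  fixes t c p :: real
  assumes "t \<ge> 0" "c > 0" "p \<ge> 1"
  shows "t \<le> c powr (1 - p) / p * t powr p + (1 - 1 / p) * c"
proof (cases "t = 0")
  case True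
  then show ?thesis
    using assms by simp
next
  case False
  have "t / c = ((t / c) powr p) powr (1 / p) * 1 powr (1 - 1 / p)"
    using assms by (simp add: powr_powr)
  also have "\<dots> \<le> 1 / p * (t / c) powr p + (1 - 1 / p) * 1"
    by (rule Youngs_inequality_0) (use assms False in auto)
  finally have "t \<le> c * (1 / p * (t / c) powr p + (1 - 1 / p))"
    using assms by (simp add: field_simps)
  also have "\<dots> = c powr (1 - p) / p * t powr p + (1 - 1 / p) * c"
    using assms by (simp add: powr_divide powr_diff field_simps)
  finally show ?thesis .
qed

text \<open>
  Monotonicity of \<open>L\<^sup>p\<close> norms on a probability space. Integrating \<open>powr_weighted_bound\<close> at the level
  \<open>c\<close> of the assumed bound gives integrability and the estimate at once.
\<close>

lemma (in prob_space) integral_le_of_moment_le: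
  fixes g :: "'a \<Rightarrow> real"
  assumes g: "g \<in> borel_measurable M" "\<And>\<omega>. g \<omega> \<ge> 0"
    and "c > 0" "p \<ge> 1"
    and moment: "(\<integral>\<^sup>+ \<omega>. ennreal (g \<omega> powr p) \<partial>M) \<le> ennreal (c powr p)"
  shows "integrable M g" and "(\<integral>\<omega>. g \<omega> \<partial>M) \<le> c"
proof -
  let ?h = "\<lambda>\<omega>. c powr (1 - p) / p * g \<omega> powr p + (1 - 1 / p) * c"
  have int_powr: "integrable M (\<lambda>\<omega>. g \<omega> powr p)"
    using g moment by (intro integrableI_nonneg) (auto simp: top.extremum_strict intro: le_less_trans)
  then have int_h: "integrable M ?h"
    by simp
  have bound: "g \<omega> \<le> ?h \<omega>" for \<omega>
    using assms by (intro powr_weighted_bound)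
  show int_g: "integrable M g"
    using int_h by (rule Bochner_Integration.integrable_bound)
      (use g in \<open>auto intro!: AE_I2 intro: order_trans[OF bound abs_ge_self]
         simp del: times_divide_eq_left\<close>)
  have "ennreal (\<integral>\<omega>. g \<omega> powr p \<partial>M) \<le> ennreal (c powr p)"
    using moment int_powr by (subst (asm) nn_integral_eq_integral) auto
  then have I: "(\<integral>\<omega>. g \<omega> powr p \<partial>M) \<le> c powr p"
    by simp
  have "(\<integral>\<omega>. g \<omega> \<partial>M) \<le> (\<integral>\<omega>. ?h \<omega> \<partial>M)"
    using int_g int_h bound by (intro integral_mono)
  also have "\<dots> = c powr (1 - p) / p * (\<integral>\<omega>. g \<omega> powr p \<partial>M) + (1 - 1 / p) * c"
    using int_powr by (simp add: prob_space)
  also have "\<dots> \<le> c powr (1 - p) / p * c powr p + (1 - 1 / p) * c"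
    using I assms by (intro add_right_mono mult_left_mono) auto
  also have "\<dots> = c"
    using assms by (simp add: powr_diff field_simps)
  finally show "(\<integral>\<omega>. g \<omega> \<partial>M) \<le> c" .
qed

text \<open>
  The infimum over couplings is not claimed to be attained, hence the strictly larger level \<open>c\<close>. A
  finite distance also excludes an empty or everywhere infinite family of transport costs.
\<close>

lemma wasserstein_le_obtains_coupling:
  assumes "wasserstein p P P' \<le> ennreal r" "0 \<le> r" "r < c" "p \<ge> 1"
  obtains \<pi> where "\<pi> \<in> couplings P P'"
    and "(\<integral>\<^sup>+ z. ennreal (norm (fst z - snd z) powr p) \<partial>\<pi>) \<le> ennreal (c powr p)"
proof -
  let ?I = "INF \<pi>\<in>couplings P P'. \<integral>\<^sup>+ (A, B). ennreal (norm (A - B) powr p) \<partial>\<pi>"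
  have fin: "?I \<noteq> \<infinity>"
    using assms(1) unfolding wasserstein_def ennreal_root_def
    by (metis ennreal_neq_top infinity_ennreal_def top_unique)
  then obtain a where a: "?I = ennreal a" "a \<ge> 0"
    by (cases ?I) auto
  have "ennreal (a powr (1 / p)) \<le> ennreal r"
    using assms(1) a fin unfolding wasserstein_def ennreal_root_def by simp
  then have "a powr (1 / p) < c"
    using assms by simp
  then have "(a powr (1 / p)) powr p < c powr p"
    using assms by (intro powr_less_mono2) auto
  then have "a < c powr p"
    using a(2) assms by (simp add: powr_powr)
  then have "?I < ennreal (c powr p)"
    using a by (simp add: ennreal_less_iff)
  then show thesis
    using that unfolding INF_less_iff case_prod_beta by (blast intro: less_imp_le)
qed

text \<open>
  The easy half of Kantorovich duality, extended from \<open>p = 1\<close> to every \<open>p \<ge> 1\<close>: under a coupling,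
  \<open>f A \<le> f B + L * norm (A - B)\<close> pointwise, and the mean of the displacement is at most its
  \<open>L\<^sup>p\<close> norm. Integrability is part of the conclusion because the integral of a non-integrable
  function is \<open>0\<close> by convention, so the estimate by itself would not show that the expectation exists.
\<close>

lemma wasserstein_ball_Lipschitz_integral_le:
  fixes f :: "real^'n^'n \<Rightarrow> real"
  assumes P: "P \<in> wasserstein_ball r p P'" and P': "P' \<in> prob_laws"
    and "r \<ge> 0" "p \<ge> 1"
    and f: "f \<in> borel_measurable borel" "integrable P' f"
    and Lip: "\<And>A B. \<bar>f A - f B\<bar> \<le> L * norm (A - B)" and "L \<ge> 0"
  shows "integrable P f" and "(\<integral>A. f A \<partial>P) \<le> (\<integral>A. f A \<partial>P') + L * r"
proof -
  have sets: "sets P = sets sym_borel" "sets P' = sets sym_borel"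
    using P P' by (auto simp: wasserstein_ball_def prob_laws_def)
  note id = measurable_of_sets_sym_borel[OF sets(1) measurable_ident]
    measurable_of_sets_sym_borel[OF sets(2) measurable_ident]
  have fP: "f \<in> borel_measurable P" "f \<in> borel_measurable P'"
    using sets f(1) by (auto intro: measurable_of_sets_sym_borel)
  have main: "integrable P f \<and> (\<integral>A. f A \<partial>P) \<le> (\<integral>A. f A \<partial>P') + L * c" if "c > r" for c
  proof -
    obtain \<pi> where \<pi>: "\<pi> \<in> couplings P P'"
      and cost: "(\<integral>\<^sup>+ z. ennreal (norm (fst z - snd z) powr p) \<partial>\<pi>) \<le> ennreal (c powr p)"
      using wasserstein_le_obtains_coupling[of p P P' r c] P \<open>c > r\<close> assms
      by (auto simp: wasserstein_ball_def)
    have sets\<pi>: "sets \<pi> = sets (P \<Otimes>\<^sub>M P')" and fst\<pi>: "distr \<pi> P fst = P" and snd\<pi>: "distr \<pi> P' snd = P'"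
      using \<pi> by (auto simp: couplings_def)
    have m [measurable]: "fst \<in> measurable \<pi> P" "snd \<in> measurable \<pi> P'"
      by (auto simp: measurable_cong_sets[OF sets\<pi> refl])
    interpret \<pi>: prob_space \<pi>
    proof (rule prob_space_distrD[OF m(1)])
      show "prob_space (distr \<pi> P fst)"
        using P by (simp add: fst\<pi> wasserstein_ball_def prob_laws_def)
    qed
    have [measurable]: "fst \<in> borel_measurable \<pi>" "snd \<in> borel_measurable \<pi>"
      using measurable_compose[OF m(1) id(1)] measurable_compose[OF m(2) id(2)] by (simp_all add: id_def)
    have dist: "integrable \<pi> (\<lambda>z. norm (fst z - snd z))" "(\<integral>z. norm (fst z - snd z) \<partial>\<pi>) \<le> c"
      using \<pi>.integral_le_of_moment_le[OF _ _ _ \<open>p \<ge> 1\<close> cost] \<open>c > r\<close> \<open>r \<ge> 0\<close> by auto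
    have int_snd: "integrable \<pi> (\<lambda>z. f (snd z))" "(\<integral>z. f (snd z) \<partial>\<pi>) = (\<integral>A. f A \<partial>P')"
      using integrable_distr_eq[OF m(2) fP(2)] integral_distr[OF m(2) fP(2)] f(2) by (simp_all add: snd\<pi>)
    have meas: "(\<lambda>z. f (fst z)) \<in> borel_measurable \<pi>"
      using fP(1) m(1) by (rule measurable_compose[rotated])
    have bound: "f (fst z) \<le> f (snd z) + L * norm (fst z - snd z)"
         "\<bar>f (fst z)\<bar> \<le> \<bar>f (snd z)\<bar> + L * norm (fst z - snd z)" for z
      using Lip[of "fst z" "snd z"] by linarith+
    have int_fst: "integrable \<pi> (\<lambda>z. f (fst z))"
      by (rule Bochner_Integration.integrable_bound
          [of _ "\<lambda>z. \<bar>f (snd z)\<bar> + L * norm (fst z - snd z)"])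
        (use int_snd dist meas bound \<open>L \<ge> 0\<close> in \<open>auto intro!: AE_I2\<close>)
    have "(\<integral>z. f (fst z) \<partial>\<pi>) \<le> (\<integral>z. f (snd z) + L * norm (fst z - snd z) \<partial>\<pi>)"
      using int_fst int_snd dist bound by (intro integral_mono) auto
    also have "\<dots> \<le> (\<integral>A. f A \<partial>P') + L * c"
      using int_snd dist \<open>L \<ge> 0\<close> by (simp add: mult_left_mono)
    finally show ?thesis
      using integrable_distr_eq[OF m(1) fP(1)] integral_distr[OF m(1) fP(1)] int_fst
      by (simp add: fst\<pi>)
  qed
  from main[of "r + 1"] show "integrable P f"
    by simp
  \<comment> \<open>Near-optimal couplings reach every level above \<open>r\<close>; the bound at \<open>r\<close> is the limit.\<close>
  have "((\<lambda>c. (\<integral>A. f A \<partial>P') + L * c) \<longlongrightarrow> (\<integral>A. f A \<partial>P') + L * r) (at_right r)"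
    by (intro tendsto_intros)
  moreover have "\<forall>\<^sub>F c in at_right r. (\<integral>A. f A \<partial>P) \<le> (\<integral>A. f A \<partial>P') + L * c"
    using main eventually_at_right_less[of r] by (auto elim: eventually_mono)
  ultimately show "(\<integral>A. f A \<partial>P) \<le> (\<integral>A. f A \<partial>P') + L * r"
    by (intro tendsto_lowerbound) auto
qed

section \<open>Empirical laws as images of a uniform law\<close>

lemma measurable_atoms:
  assumes "\<And>i. i \<in> I \<Longrightarrow> Q i \<in> sym_matrices"
  shows "Q \<in> measurable (uniform_count_measure I) sym_borel"
  using assms
  by (auto simp: measurable_cong_sets[OF sets_uniform_count_measure_count_space refl] space_restrict_space)

text \<open>
  Realising the law as the image of a uniformly random index makes its integrals finite averages, and
  lets two empirical laws be coupled through a common index.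
\<close>

lemma empirical_law_eq_distr:
  fixes Q :: "nat \<Rightarrow> real^'n^'n"
  assumes "N \<ge> 1" and "\<And>i. i \<in> {1..N} \<Longrightarrow> Q i \<in> sym_matrices"
  shows "empirical_law N Q = distr (uniform_count_measure {1..N}) sym_borel Q"
proof (rule measure_eqI)
  show sets: "sets (empirical_law N Q) = sets (distr (uniform_count_measure {1..N}) sym_borel Q)"
    by (simp add: empirical_law_def)
  fix A assume "A \<in> sets (empirical_law N Q)"
  then have A: "A \<in> sets sym_borel"
    by (simp add: sets)
  have meas: "Q \<in> measurable (uniform_count_measure {1..N}) sym_borel"
    using assms(2) by (rule measurable_atoms)
  have "(\<Sum>i=1..N. emeasure (return sym_borel (Q i)) A) = of_nat (card {i\<in>{1..N}. Q i \<in> A})"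
    using A by (simp add: indicator_def sum.If_cases Int_def)
  moreover have "emeasure (distr (uniform_count_measure {1..N}) sym_borel Q) A
      = ennreal (card {i\<in>{1..N}. Q i \<in> A} / N)"
    using A meas
    by (simp add: emeasure_distr emeasure_uniform_count_measure space_uniform_count_measure)
       (auto intro!: arg_cong[where f=card])
  ultimately show "emeasure (empirical_law N Q) A
      = emeasure (distr (uniform_count_measure {1..N}) sym_borel Q) A"
    using assms(1) A
    by (simp add: emeasure_empirical_law ennreal_of_nat_eq_real_of_nat divide_ennreal[symmetric]
       ennreal_divide_times)
qed

lemma integral_empirical_law:
  fixes f :: "real^'n^'n \<Rightarrow> real"
  assumes "N \<ge> 1" and "\<And>i. i \<in> {1..N} \<Longrightarrow> Q i \<in> sym_matrices"
    and f: "f \<in> borel_measurable borel"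
  shows "integrable (empirical_law N Q) f"
    and "(\<integral>A. f A \<partial>empirical_law N Q) = (\<Sum>i=1..N. f (Q i)) / N"
proof -
  have meas: "Q \<in> measurable (uniform_count_measure {1..N}) sym_borel"
    using assms(2) by (rule measurable_atoms)
  have eq: "empirical_law N Q = distr (uniform_count_measure {1..N}) sym_borel Q"
    using assms(1,2) by (rule empirical_law_eq_distr)
  have f': "f \<in> borel_measurable sym_borel"
    using f by (rule measurable_restrict_space1)
  have "integrable (uniform_count_measure {1..N}) (\<lambda>i. f (Q i))"
    unfolding uniform_count_measure_def by (rule integrable_point_measure_finite) simp
  then show "integrable (empirical_law N Q) f"
    unfolding eq integrable_distr_eq[OF meas f'] .
  show "(\<integral>A. f A \<partial>empirical_law N Q) = (\<Sum>i=1..N. f (Q i)) / N"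
    unfolding eq integral_distr[OF meas f'] by (simp add: integral_uniform_count_measure)
qed

lemma integral_quadratic_form_empirical_law:
  fixes Q :: "nat \<Rightarrow> real^'n^'n"
  assumes "N \<ge> 1" and "\<And>i. i \<in> {1..N} \<Longrightarrow> Q i \<in> sym_matrices"
  shows "integrable (empirical_law N Q) (\<lambda>A. x \<bullet> (A *v x))"
    and "(\<integral>A. x \<bullet> (A *v x) \<partial>empirical_law N Q) = x \<bullet> (empirical_mean N Q *v x)"
  using integral_empirical_law[where f = "\<lambda>A. x \<bullet> (A *v x)", OF assms borel_measurable_quadratic_form]
  by (simp_all add: quadratic_form_eq_inner_outer_square empirical_mean_def inner_sum_left)

text \<open>
  The coupling that sends each atom to its own translate has constant displacement \<open>D\<close>, so its cost is
  \<open>norm D powr p\<close> whatever the atoms are. Coinciding atoms cause no difficulty, because the coupling is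
  built on indices rather than on matrices.
\<close>

lemma shifted_empirical_law_in_wasserstein_ball:
  fixes Q :: "nat \<Rightarrow> real^'n^'n"
  assumes "N \<ge> 1" and "\<And>i. i \<in> {1..N} \<Longrightarrow> Q i \<in> sym_matrices"
    and D: "D \<in> sym_matrices" "norm D \<le> r" and "p \<ge> 1"
  shows "empirical_law N (\<lambda>i. Q i + D) \<in> wasserstein_ball r p (empirical_law N Q)"
proof -
  let ?U = "uniform_count_measure {1..N}"
  let ?Q' = "\<lambda>i. Q i + D"
  let ?P = "empirical_law N ?Q'" and ?P' = "empirical_law N Q"
  have sym': "?Q' i \<in> sym_matrices" if "i \<in> {1..N}" for i
    using assms that by (simp add: sym_matrices_add)
  have P: "?P = distr ?U sym_borel ?Q'" and P': "?P' = distr ?U sym_borel Q"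
    by (intro empirical_law_eq_distr assms sym'; assumption)+
  have sets: "sets ?P = sets sym_borel" "sets ?P' = sets sym_borel"
    by (simp_all add: empirical_law_def)
  have m: "?Q' \<in> measurable ?U ?P" "Q \<in> measurable ?U ?P'"
    using measurable_atoms[where Q = ?Q', OF sym'] measurable_atoms[where Q = Q, OF assms(2)]
    by (simp_all add: measurable_cong_sets[OF refl sets(1)] measurable_cong_sets[OF refl sets(2)])
  let ?\<pi> = "distr ?U (?P \<Otimes>\<^sub>M ?P') (\<lambda>i. (?Q' i, Q i))"
  have m2: "(\<lambda>i. (?Q' i, Q i)) \<in> measurable ?U (?P \<Otimes>\<^sub>M ?P')"
    using m by (rule measurable_Pair)
  have "distr ?\<pi> ?P fst = ?P"
    by (subst distr_distr[OF measurable_fst m2]) (auto simp: comp_def P intro!: distr_cong)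
  moreover have "distr ?\<pi> ?P' snd = ?P'"
    by (subst distr_distr[OF measurable_snd m2]) (auto simp: comp_def P' intro!: distr_cong)
  ultimately have coupling: "?\<pi> \<in> couplings ?P ?P'"
    by (simp add: couplings_def)
  note id = measurable_of_sets_sym_borel[OF sets(1) measurable_ident]
    measurable_of_sets_sym_borel[OF sets(2) measurable_ident]
  have [measurable]: "fst \<in> borel_measurable (?P \<Otimes>\<^sub>M ?P')" "snd \<in> borel_measurable (?P \<Otimes>\<^sub>M ?P')"
    using measurable_compose[OF measurable_fst id(1)] measurable_compose[OF measurable_snd id(2)]
    by (simp_all add: id_def)
  have "(\<integral>\<^sup>+ (A, B). ennreal (norm (A - B) powr p) \<partial>?\<pi>)
      = (\<integral>\<^sup>+ i. ennreal (norm D powr p) \<partial>?U)"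
    by (subst nn_integral_distr[OF m2]) (simp_all add: case_prod_beta)
  also have "\<dots> = ennreal (norm D powr p)"
    using prob_space.emeasure_space_1[OF prob_space_uniform_count_measure[of "{1..N}"]] \<open>N \<ge> 1\<close>
    by simp
  finally have cost: "(INF \<pi>\<in>couplings ?P ?P'. \<integral>\<^sup>+ (A, B). ennreal (norm (A - B) powr p) \<partial>\<pi>)
      \<le> ennreal (norm D powr p)"
    using coupling by (metis (no_types, lifting) INF_lower)
  have root: "ennreal_root p a \<le> ennreal r" if "a \<le> ennreal (norm D powr p)" for a
  proof -
    have fin: "a \<noteq> \<infinity>"
      using that by (auto simp: top_unique)
    then obtain b where b: "a = ennreal b" "b \<ge> 0"
      by (cases a) auto
    have "b \<le> norm D powr p"
      using that b by simp
    then have "b powr (1 / p) \<le> (norm D powr p) powr (1 / p)"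
      using b assms by (intro powr_mono2) auto
    also have "\<dots> \<le> r"
      using assms by (simp add: powr_powr)
    finally show ?thesis
      using b by (simp add: ennreal_root_def ennreal_leI)
  qed
  show ?thesis
    using root[OF cost] empirical_law_in_prob_laws[OF assms(1) sym']
    by (simp add: wasserstein_ball_def wasserstein_def)
qed

section \<open>The worst-case quadratic form\<close>

text \<open>
  The supremum is a maximum: for \<open>x \<noteq> 0\<close>, \<open>x x\<^sup>T\<close> rescaled to norm \<open>r\<close> is the shift along which the Lipschitz
  estimate is an equality.
\<close>

lemma worst_case_quadratic_form:
  fixes Q :: "nat \<Rightarrow> real^'n^'n"
  assumes "N \<ge> 1" and "\<And>i. i \<in> {1..N} \<Longrightarrow> Q i \<in> sym_matrices" and "p \<ge> 1" and "r \<ge> 0"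
  shows "(SUP P\<in>wasserstein_ball r p (empirical_law N Q). ereal (\<integral>A. x \<bullet> (A *v x) \<partial>P))
       = ereal (x \<bullet> (empirical_mean N Q *v x) + r * (x \<bullet> x))"
proof (rule antisym)
  show "(SUP P\<in>wasserstein_ball r p (empirical_law N Q). ereal (\<integral>A. x \<bullet> (A *v x) \<partial>P))
      \<le> ereal (x \<bullet> (empirical_mean N Q *v x) + r * (x \<bullet> x))"
  proof (rule SUP_least)
    fix P assume P: "P \<in> wasserstein_ball r p (empirical_law N Q)"
    have nominal: "(\<integral>A. x \<bullet> (A *v x) \<partial>empirical_law N Q) = x \<bullet> (empirical_mean N Q *v x)"
      using assms(1,2) by (rule integral_quadratic_form_empirical_law)
    have "(\<integral>A. x \<bullet> (A *v x) \<partial>P) \<le> (\<integral>A. x \<bullet> (A *v x) \<partial>empirical_law N Q) + (x \<bullet> x) * r"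
      using P empirical_law_in_prob_laws[OF assms(1,2)] assms(4,3) borel_measurable_quadratic_form
        integral_quadratic_form_empirical_law(1)[OF assms(1,2)] quadratic_form_Lipschitz inner_ge_zero
      by (rule wasserstein_ball_Lipschitz_integral_le)
    then show "ereal (\<integral>A. x \<bullet> (A *v x) \<partial>P) \<le> ereal (x \<bullet> (empirical_mean N Q *v x) + r * (x \<bullet> x))"
      by (simp add: nominal mult.commute)
  qed
next
  \<comment> \<open>For \<open>x = 0\<close> the quotient is \<open>0\<close> and so is \<open>D\<close>; both sides of the claim then vanish.\<close>
  define D where "D = (r / (x \<bullet> x)) *\<^sub>R outer_square x"
  have D: "D \<in> sym_matrices" "norm D \<le> r"
    using assms(4)
    by (simp_all add: D_def norm_outer_square sym_matrices_scaleR outer_square_in_sym_matrices)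
  have value_D: "x \<bullet> (D *v x) = r * (x \<bullet> x)"
    by (simp add: D_def outer_square_mult_vec flip: scaleR_matrix_vector_assoc)
  have mean: "empirical_mean N (\<lambda>i. Q i + D) = empirical_mean N Q + D"
    using assms(1)
    by (simp add: empirical_mean_def sum.distrib scaleR_right_distrib sum_constant_scaleR del: sum_constant)
  have sym': "Q i + D \<in> sym_matrices" if "i \<in> {1..N}" for i
    using assms D that by (simp add: sym_matrices_add)
  have "x \<bullet> (empirical_mean N Q *v x) + r * (x \<bullet> x)
      = (\<integral>A. x \<bullet> (A *v x) \<partial>empirical_law N (\<lambda>i. Q i + D))"
    using integral_quadratic_form_empirical_law(2)[OF assms(1) sym']
    by (simp add: mean matrix_vector_mult_add_rdistrib inner_add_right value_D)
  then show "ereal (x \<bullet> (empirical_mean N Q *v x) + r * (x \<bullet> x))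
      \<le> (SUP P\<in>wasserstein_ball r p (empirical_law N Q). ereal (\<integral>A. x \<bullet> (A *v x) \<partial>P))"
    using shifted_empirical_law_in_wasserstein_ball[OF assms(1,2) D assms(3)]
    by (auto intro: SUP_upper)
qed

theorem corollary3p8:
  fixes Q :: "nat \<Rightarrow> real^'n^'n" and N :: nat and p :: real and \<theta> :: "real^'n \<Rightarrow> real"
  assumes "N \<ge> 1"
    and "\<And>i. i \<in> {1..N} \<Longrightarrow> Q i \<in> sym_matrices"
    and "p \<ge> 1"
    and "\<And>x. x \<in> unit_simplex \<Longrightarrow> \<theta> x > 0"
  shows "(INF x\<in>unit_simplex. SUP P\<in>wasserstein_ball (\<theta> x) p (empirical_law N Q).
            ereal (\<integral>A. x \<bullet> (A *v x) \<partial>P))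
         = (INF x\<in>unit_simplex. ereal (x \<bullet> ((empirical_mean N Q + \<theta> x *\<^sub>R mat 1) *v x)))
       \<and> (INF x\<in>unit_simplex. ereal (x \<bullet> ((empirical_mean N Q + \<theta> x *\<^sub>R mat 1) *v x)))
         = (INF x\<in>unit_simplex. ereal (x \<bullet> (empirical_mean N Q *v x) + \<theta> x * (x \<bullet> x)))"
proof -
  have expand: "x \<bullet> ((empirical_mean N Q + \<theta> x *\<^sub>R mat 1) *v x)
      = x \<bullet> (empirical_mean N Q *v x) + \<theta> x * (x \<bullet> x)" for x
    by (simp add: matrix_vector_mult_add_rdistrib inner_add_right flip: scaleR_matrix_vector_assoc)
  have worst: "(SUP P\<in>wasserstein_ball (\<theta> x) p (empirical_law N Q). ereal (\<integral>A. x \<bullet> (A *v x) \<partial>P))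
      = ereal (x \<bullet> (empirical_mean N Q *v x) + \<theta> x * (x \<bullet> x))" if "x \<in> unit_simplex" for x
    using assms that by (intro worst_case_quadratic_form) (auto intro: less_imp_le)
  show ?thesis
    unfolding expand by (simp add: worst cong: INF_cong)
qed

end
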